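(* For every Tychonoff space $X$, the free locally convex space $L(X)$ over $X$ has the Dunford--Pettis property.
   Context: Locally convex spaces (lcs) are real and Hausdorff; Tychonoff means completely regular and Hausdorff. The free locally convex space over a Tychonoff space $X$ is an lcs $L(X)$ with a continuous map $i:X\to L(X)$ such that for every continuous map $f$ from $X$ to an lcs $E$ there is a unique continuous linear operator $\bar f:L(X)\to E$ with $f=\bar f\circ i$. It exists and is essentially unique, and $i$ is a topological embedding whose image is a Hamel basis of $L(X)$. An lcs $E$ has the Dunford--Pettis property if every continuous linear operator $T$ from $E$ into a quasi-complete lcs $F$ which transforms bounded subsets of $E$ into relatively weakly compact subsets of $F$ also transforms absolutely convex weakly compact subsets of $E$ into relatively compact subsets of $F$. (An lcs is quasi-complete if each of its closed bounded subsets is complete.) *)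

theory Defs
  imports "HOL-Analysis.Analysis"
begin

text \<open>
  A topological vector space is a topology \<open>E\<close> whose carrier \<open>topspace E\<close> is a linear subspace
  of a real vector space type; it carries the linear structure of that type, and its topology is
  unrelated to any topology of the ambient type.
\<close>

definition topological_vector_space :: "'a::real_vector topology \<Rightarrow> bool" where
  "topological_vector_space E \<longleftrightarrow>
     subspace (topspace E) \<and>
     continuous_map (prod_topology E E) E (\<lambda>(x, y). x + y) \<and>
     continuous_map (prod_topology euclideanreal E) E (\<lambda>(c, x). c *\<^sub>R x)"

definition locally_convex_space :: "'a::real_vector topology \<Rightarrow> bool" where
  "locally_convex_space E \<longleftrightarrow>
     topological_vector_space E \<and> Hausdorff_space E \<and>
     (\<forall>U. openin E U \<and> 0 \<in> U \<longrightarrow> (\<exists>V. openin E V \<and> 0 \<in> V \<and> convex V \<and> V \<subseteq> U))"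

definition linear_map_on :: "'a::real_vector set \<Rightarrow> ('a \<Rightarrow> 'b::real_vector) \<Rightarrow> bool" where
  "linear_map_on S f \<longleftrightarrow>
     (\<forall>x\<in>S. \<forall>y\<in>S. f (x + y) = f x + f y) \<and> (\<forall>c. \<forall>x\<in>S. f (c *\<^sub>R x) = c *\<^sub>R f x)"

definition continuous_linear_operator ::
    "'a::real_vector topology \<Rightarrow> 'b::real_vector topology \<Rightarrow> ('a \<Rightarrow> 'b) \<Rightarrow> bool" where
  "continuous_linear_operator E F T \<longleftrightarrow> continuous_map E F T \<and> linear_map_on (topspace E) T"

definition weak_topology :: "'a::real_vector topology \<Rightarrow> 'a topology" where
  "weak_topology E = topology_generated_by
     {{x \<in> topspace E. \<phi> x \<in> U} | \<phi> U. continuous_linear_operator E euclideanreal \<phi> \<and> open U}"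

definition tvs_bounded :: "'a::real_vector topology \<Rightarrow> 'a set \<Rightarrow> bool" where
  "tvs_bounded E B \<longleftrightarrow>
     B \<subseteq> topspace E \<and>
     (\<forall>U. openin E U \<and> 0 \<in> U \<longrightarrow> (\<exists>r>0. \<forall>c. r \<le> \<bar>c\<bar> \<longrightarrow> B \<subseteq> (*\<^sub>R) c ` U))"

definition absolutely_convex :: "'a::real_vector set \<Rightarrow> bool" where
  "absolutely_convex A \<longleftrightarrow> convex A \<and> (\<forall>c. \<forall>x\<in>A. \<bar>c\<bar> \<le> 1 \<longrightarrow> c *\<^sub>R x \<in> A)"

definition relatively_compactin :: "'a topology \<Rightarrow> 'a set \<Rightarrow> bool" where
  "relatively_compactin X A \<longleftrightarrow> A \<subseteq> topspace X \<and> compactin X (X closure_of A)"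

definition tvs_Cauchy_filter :: "'a::real_vector topology \<Rightarrow> 'a filter \<Rightarrow> bool" where
  "tvs_Cauchy_filter E \<F> \<longleftrightarrow>
     (\<forall>U. openin E U \<and> 0 \<in> U \<longrightarrow>
        (\<exists>A. eventually (\<lambda>x. x \<in> A) \<F> \<and> (\<forall>x\<in>A. \<forall>y\<in>A. x - y \<in> U)))"

definition tvs_complete :: "'a::real_vector topology \<Rightarrow> 'a set \<Rightarrow> bool" where
  "tvs_complete E S \<longleftrightarrow>
     (\<forall>\<F>. \<F> \<noteq> bot \<and> eventually (\<lambda>x. x \<in> S) \<F> \<and> tvs_Cauchy_filter E \<F> \<longrightarrow>
        (\<exists>l\<in>S. limitin E (\<lambda>x. x) l \<F>))"

definition quasi_complete :: "'a::real_vector topology \<Rightarrow> bool" where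
  "quasi_complete E \<longleftrightarrow> (\<forall>S. closedin E S \<and> tvs_bounded E S \<longrightarrow> tvs_complete E S)"

text \<open>
  The range spaces \<open>F\<close> live in the type given by the first argument. A statement
  about all range spaces leaves that type variable free.
\<close>

definition Dunford_Pettis_property ::
    "'f::real_vector itself \<Rightarrow> 'a::real_vector topology \<Rightarrow> bool" where
  "Dunford_Pettis_property _ E \<longleftrightarrow>
     (\<forall>(F :: 'f topology) T.
        locally_convex_space F \<and> quasi_complete F \<and> continuous_linear_operator E F T \<and>
        (\<forall>B. tvs_bounded E B \<longrightarrow> relatively_compactin (weak_topology F) (T ` B)) \<longrightarrow>
        (\<forall>K. absolutely_convex K \<and> compactin (weak_topology E) K \<longrightarrow>
             relatively_compactin F (T ` K)))"

definition Tychonoff_space :: "'x topology \<Rightarrow> bool" where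
  "Tychonoff_space X \<longleftrightarrow> completely_regular_space X \<and> Hausdorff_space X"

text \<open>
  A definition cannot quantify over the types of the test spaces \<open>E\<close>, so the universal property
  is required for \<open>E\<close> with carrier in \<open>'l \<times> real\<close>, where \<open>'l\<close> is the type of \<open>L\<close>. This is no
  restriction: by \<open>free_locally_convex_space_universal\<close> below, the universal property then holds
  for locally convex spaces \<open>E\<close> over any type.
\<close>

definition extends_uniquely ::
    "'x topology \<Rightarrow> 'l::real_vector topology \<Rightarrow> ('x \<Rightarrow> 'l) \<Rightarrow>
     'e::real_vector topology \<Rightarrow> ('x \<Rightarrow> 'e) \<Rightarrow> bool"
  where
  "extends_uniquely X L i E f \<longleftrightarrow>
     (\<exists>g. continuous_linear_operator L E g \<and> (\<forall>x\<in>topspace X. f x = g (i x)) \<and>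
        (\<forall>h. continuous_linear_operator L E h \<and> (\<forall>x\<in>topspace X. f x = h (i x)) \<longrightarrow>
             (\<forall>v\<in>topspace L. h v = g v)))"

definition free_locally_convex_space ::
    "'x topology \<Rightarrow> 'l::real_vector topology \<Rightarrow> ('x \<Rightarrow> 'l) \<Rightarrow> bool" where
  "free_locally_convex_space X L i \<longleftrightarrow>
     locally_convex_space L \<and> continuous_map X L i \<and>
     (\<forall>(E :: ('l \<times> real) topology) f.
        locally_convex_space E \<and> continuous_map X E f \<longrightarrow> extends_uniquely X L i E f)"

lemma lcsD:
  assumes "locally_convex_space E"
  shows "subspace (topspace E)"
    and "continuous_map (prod_topology E E) E (\<lambda>(x, y). x + y)"
    and "continuous_map (prod_topology euclideanreal E) E (\<lambda>(c, x). c *\<^sub>R x)"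
    and "Hausdorff_space E"
    and "\<And>U. openin E U \<Longrightarrow> 0 \<in> U \<Longrightarrow> \<exists>V. openin E V \<and> 0 \<in> V \<and> convex V \<and> V \<subseteq> U"
  using assms unfolding locally_convex_space_def topological_vector_space_def by blast+

lemma lcs_pullback:
  fixes g :: "'a::real_vector \<Rightarrow> 'b::real_vector"
  assumes E: "locally_convex_space E" and S: "subspace S" and lin: "linear_map_on S g"
    and im: "g ` S \<subseteq> topspace E" and inj: "inj_on g S"
  shows "locally_convex_space (pullback_topology S g E)" (is "locally_convex_space ?P")
proof -
  have ts: "topspace ?P = S"
    using im by (auto simp: topspace_pullback_topology)
  have cg: "continuous_map ?P E g"
    using continuous_map_pullback[OF continuous_map_id, where f = g and A = S] by (simp add: o_def id_def)
  have g0: "g 0 = 0"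
    using lin subspace_0[OF S] unfolding linear_map_on_def by (metis scaleR_zero_left)
  have toP: "continuous_map X ?P f"
    if "continuous_map X E (g \<circ> f)" "f ` topspace X \<subseteq> S" for X :: "'c topology" and f
    by (rule continuous_map_pullback') (use that in auto)
  have add: "continuous_map (prod_topology ?P ?P) ?P (\<lambda>(x, y). x + y)"
  proof (rule continuous_map_pullback')
    have "continuous_map (prod_topology ?P ?P) (prod_topology E E) (\<lambda>(x, y). (g x, g y))"
      using cg by (simp add: continuous_map_prod_top)
    from continuous_map_compose[OF this lcsD(2)[OF E]]
    have "continuous_map (prod_topology ?P ?P) E (\<lambda>(x, y). g x + g y)"
      by (simp add: o_def case_prod_unfold)
    then show "continuous_map (prod_topology ?P ?P) E (g \<circ> (\<lambda>(x, y). x + y))"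
      by (rule continuous_map_eq) (use lin ts in \<open>auto simp: linear_map_on_def\<close>)
    show "topspace (prod_topology ?P ?P) \<subseteq> (\<lambda>(x, y). x + y) -` S"
      using S ts by (auto simp: subspace_add)
  qed
  have scal: "continuous_map (prod_topology euclideanreal ?P) ?P (\<lambda>(c, x). c *\<^sub>R x)"
  proof (rule continuous_map_pullback')
    have "continuous_map (prod_topology euclideanreal ?P) (prod_topology euclideanreal E)
            (\<lambda>(x, y). (x, g y))"
      using cg by (simp add: continuous_map_prod_top)
    from continuous_map_compose[OF this lcsD(3)[OF E]]
    have "continuous_map (prod_topology euclideanreal ?P) E (\<lambda>(x, y). x *\<^sub>R g y)"
      by (simp add: o_def case_prod_unfold)
    then show "continuous_map (prod_topology euclideanreal ?P) E (g \<circ> (\<lambda>(c, x). c *\<^sub>R x))"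
      by (rule continuous_map_eq) (use lin ts in \<open>auto simp: linear_map_on_def\<close>)
    show "topspace (prod_topology euclideanreal ?P) \<subseteq> (\<lambda>(c, x). c *\<^sub>R x) -` S"
      using S ts by (auto simp: subspace_scale)
  qed
  have haus: "Hausdorff_space ?P"
    by (rule Hausdorff_space_injective_preimage[OF lcsD(4)[OF E] cg]) (use inj ts in simp)
  have conv: "\<exists>V. openin ?P V \<and> 0 \<in> V \<and> convex V \<and> V \<subseteq> U" if U: "openin ?P U" "0 \<in> U" for U
  proof -
    obtain W where W: "openin E W" "U = g -` W \<inter> S"
      using U by (auto simp: openin_pullback_topology)
    have "0 \<in> W" using W(2) U(2) g0 by auto
    then obtain V where V: "openin E V" "0 \<in> V" "convex V" "V \<subseteq> W"
      using lcsD(5)[OF E W(1)] by blast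
    have "convex (g -` V \<inter> S)"
    proof (rule convexI)
      fix x y u v :: real and a b
      assume a: "a \<in> g -` V \<inter> S" and b: "b \<in> g -` V \<inter> S" and uv: "0 \<le> u" "0 \<le> v" "u + v = 1"
      have "g (u *\<^sub>R a + v *\<^sub>R b) = u *\<^sub>R g a + v *\<^sub>R g b"
        using a b lin S unfolding linear_map_on_def by (simp add: subspace_scale)
      then show "u *\<^sub>R a + v *\<^sub>R b \<in> g -` V \<inter> S"
        using a b uv V(3) S by (auto simp: convex_def subspace_add subspace_scale)
    qed
    moreover have "openin ?P (g -` V \<inter> S)"
      using V(1) by (auto simp: openin_pullback_topology)
    ultimately show ?thesis
      using V g0 W(2) subspace_0[OF S] by (intro exI[of _ "g -` V \<inter> S"]) auto
  qed
  show ?thesis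
    unfolding locally_convex_space_def topological_vector_space_def
    using S ts add scal haus conv by auto
qed

lemma lcs_prod:
  fixes E :: "'a::real_vector topology" and F :: "'b::real_vector topology"
  assumes E: "locally_convex_space E" and F: "locally_convex_space F"
  shows "locally_convex_space (prod_topology E F)" (is "locally_convex_space ?P")
proof -
  have sub: "subspace (topspace ?P)"
    using lcsD(1)[OF E] lcsD(1)[OF F] by (simp add: subspace_Times)
  have haus: "Hausdorff_space ?P"
    using lcsD(4)[OF E] lcsD(4)[OF F] by (simp add: Hausdorff_space_prod_topology)
  have f: "continuous_map ?P E fst" and s: "continuous_map ?P F snd"
    by (auto simp: continuous_map_fst continuous_map_snd)
  have add: "continuous_map (prod_topology ?P ?P) ?P (\<lambda>(x, y). x + y)"
  proof -
    have "continuous_map (prod_topology ?P ?P) (prod_topology E E) (\<lambda>(x, y). (fst x, fst y))"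
      using f by (simp add: continuous_map_prod_top)
    from continuous_map_compose[OF this lcsD(2)[OF E]]
    have 1: "continuous_map (prod_topology ?P ?P) E (\<lambda>z. fst (fst z) + fst (snd z))"
      by (simp add: o_def case_prod_unfold)
    have "continuous_map (prod_topology ?P ?P) (prod_topology F F) (\<lambda>(x, y). (snd x, snd y))"
      using s by (simp add: continuous_map_prod_top)
    from continuous_map_compose[OF this lcsD(2)[OF F]]
    have 2: "continuous_map (prod_topology ?P ?P) F (\<lambda>z. snd (fst z) + snd (snd z))"
      by (simp add: o_def case_prod_unfold)
    show ?thesis
      using continuous_map_pairedI[OF 1 2] by (simp add: case_prod_unfold plus_prod_def)
  qed
  have scal: "continuous_map (prod_topology euclideanreal ?P) ?P (\<lambda>(c, x). c *\<^sub>R x)"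
  proof -
    have "continuous_map (prod_topology euclideanreal ?P) (prod_topology euclideanreal E)
            (\<lambda>(x, y). (x, fst y))"
      using f by (simp add: continuous_map_prod_top)
    from continuous_map_compose[OF this lcsD(3)[OF E]]
    have 1: "continuous_map (prod_topology euclideanreal ?P) E (\<lambda>z. fst z *\<^sub>R fst (snd z))"
      by (simp add: o_def case_prod_unfold)
    have "continuous_map (prod_topology euclideanreal ?P) (prod_topology euclideanreal F)
            (\<lambda>(x, y). (x, snd y))"
      using s by (simp add: continuous_map_prod_top)
    from continuous_map_compose[OF this lcsD(3)[OF F]]
    have 2: "continuous_map (prod_topology euclideanreal ?P) F (\<lambda>z. fst z *\<^sub>R snd (snd z))"
      by (simp add: o_def case_prod_unfold)
    show ?thesis
      using continuous_map_pairedI[OF 1 2] by (simp add: case_prod_unfold scaleR_prod_def)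
  qed
  have conv: "\<exists>V. openin ?P V \<and> 0 \<in> V \<and> convex V \<and> V \<subseteq> U" if U: "openin ?P U" "0 \<in> U" for U
  proof -
    obtain A B where AB: "openin E A" "openin F B" "(0, 0) \<in> A \<times> B" "A \<times> B \<subseteq> U"
      using U unfolding openin_prod_topology_alt zero_prod_def by (metis mem_Sigma_iff)
    obtain A' where A': "openin E A'" "0 \<in> A'" "convex A'" "A' \<subseteq> A"
      using lcsD(5)[OF E AB(1)] AB(3) by auto
    obtain B' where B': "openin F B'" "0 \<in> B'" "convex B'" "B' \<subseteq> B"
      using lcsD(5)[OF F AB(2)] AB(3) by auto
    show ?thesis
      using A' B' AB(4)
      by (intro exI[of _ "A' \<times> B'"])
        (auto simp: openin_prod_Times_iff convex_Times zero_prod_def)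
  qed
  show ?thesis
    unfolding locally_convex_space_def topological_vector_space_def
    using sub add scal haus conv by auto
qed

lemma lcs_euclideanreal: "locally_convex_space euclideanreal"
proof -
  have 1: "continuous_map (prod_topology euclideanreal euclideanreal) euclideanreal
             (\<lambda>(x, y). x + y)"
    by (auto simp: case_prod_unfold intro!: continuous_intros)
  have 2: "continuous_map (prod_topology euclideanreal euclideanreal) euclideanreal
             (\<lambda>(x::real, y::real). x *\<^sub>R y)"
    by (auto simp: case_prod_unfold intro!: continuous_intros)
  have 3: "\<exists>V. open V \<and> 0 \<in> V \<and> convex V \<and> V \<subseteq> U" if "open U" "0 \<in> U" for U :: "real set"
    using that by (metis centre_in_ball convex_ball open_ball open_contains_ball)
  show ?thesis
    unfolding locally_convex_space_def topological_vector_space_def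
    using 1 2 3 by (simp add: Hausdorff_space_euclidean case_prod_unfold)
qed

lemma lcs_zero: "locally_convex_space (discrete_topology {0::'a::real_vector})"
proof -
  have 1: "continuous_map (prod_topology (discrete_topology {0}) (discrete_topology {0}))
             (discrete_topology {0::'a}) (\<lambda>(x, y). x + y)"
    by (rule continuous_map_eq[of _ _ "\<lambda>_. 0"]) auto
  have 2: "continuous_map (prod_topology euclideanreal (discrete_topology {0}))
             (discrete_topology {0::'a}) (\<lambda>(c, x). c *\<^sub>R x)"
    by (rule continuous_map_eq[of _ _ "\<lambda>_. 0"]) auto
  show ?thesis
    unfolding locally_convex_space_def topological_vector_space_def
    using 1 2 by (auto simp: subspace_single_0)
qed

lemma linear_map_on_span_eq:
  fixes g h :: "'a::real_vector \<Rightarrow> 'b::real_vector"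
  assumes g: "linear_map_on (span B) g" and h: "linear_map_on (span B) h"
    and eq: "\<And>b. b \<in> B \<Longrightarrow> g b = h b" and v: "v \<in> span B"
  shows "g v = h v"
proof -
  have "v \<in> span B \<and> g v = h v"
    using v
  proof (induction rule: span_induct_alt)
    case base
    show ?case
      using g h unfolding linear_map_on_def by (metis scaleR_zero_left span_zero)
  next
    case (step c x y)
    have x: "x \<in> span B" and cx: "c *\<^sub>R x \<in> span B" and y: "y \<in> span B"
      using step by (auto intro: span_base span_scale)
    have lin: "f (c *\<^sub>R x + y) = c *\<^sub>R f x + f y" if "linear_map_on (span B) f" for f :: "'a \<Rightarrow> 'b"
      using that x cx y unfolding linear_map_on_def by simp
    show ?case
      using lin[OF g] lin[OF h] eq[OF step.hyps(1)] step.IH span_add[OF cx y] by simp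
  qed
  then show ?thesis by simp
qed

lemma free_lcs_extends:
  fixes E :: "('l::real_vector \<times> real) topology"
  assumes "free_locally_convex_space X (L :: 'l topology) i"
    and "locally_convex_space E" "continuous_map X E f"
  shows "extends_uniquely X L i E f"
  using assms unfolding free_locally_convex_space_def by blast

lemma free_lcs_functional:
  fixes L :: "'l::real_vector topology"
  assumes free: "free_locally_convex_space X L i" and \<phi>: "continuous_map X euclideanreal \<phi>"
  obtains g where "continuous_linear_operator L euclideanreal g"
    and "\<And>x. x \<in> topspace X \<Longrightarrow> g (i x) = \<phi> x"
proof -
  let ?E = "prod_topology (discrete_topology {0::'l}) euclideanreal"
  have "continuous_map X ?E (\<lambda>x. (0, \<phi> x))"
    using \<phi> by (intro continuous_map_pairedI) auto
  from free_lcs_extends[OF free lcs_prod[OF lcs_zero lcs_euclideanreal] this]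
  obtain g where g: "continuous_linear_operator L ?E g" "\<And>x. x \<in> topspace X \<Longrightarrow> (0, \<phi> x) = g (i x)"
    unfolding extends_uniquely_def by blast
  have "continuous_map L euclideanreal (snd \<circ> g)"
    using g(1) unfolding continuous_linear_operator_def
    by (meson continuous_map_compose continuous_map_snd)
  moreover have "linear_map_on (topspace L) (snd \<circ> g)"
    using g(1) unfolding continuous_linear_operator_def linear_map_on_def by simp
  ultimately have 1: "continuous_linear_operator L euclideanreal (snd \<circ> g)"
    unfolding continuous_linear_operator_def by simp
  have 2: "(snd \<circ> g) (i x) = \<phi> x" if "x \<in> topspace X" for x
    using arg_cong[OF g(2)[OF that], of snd] by simp
  show ?thesis
    using 1 2 by (rule that)
qed

text \<open>A convenient form of the universal property for test spaces over the type of \<open>L\<close> itself.\<close>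

lemma free_lcs_extends':
  fixes L E :: "'l::real_vector topology"
  assumes free: "free_locally_convex_space X L i"
    and E: "locally_convex_space E" and f: "continuous_map X E f"
  shows "extends_uniquely X L i E f"
proof -
  let ?Z = "discrete_topology {0::real}"
  have "continuous_map X (prod_topology E ?Z) (\<lambda>x. (f x, 0))"
    using f by (intro continuous_map_pairedI) auto
  from free_lcs_extends[OF free lcs_prod[OF E lcs_zero] this]
  obtain g where g: "continuous_linear_operator L (prod_topology E ?Z) g"
      "\<And>x. x \<in> topspace X \<Longrightarrow> (f x, 0) = g (i x)"
    and un: "\<And>h v. continuous_linear_operator L (prod_topology E ?Z) h \<Longrightarrow>
        (\<And>x. x \<in> topspace X \<Longrightarrow> (f x, 0) = h (i x)) \<Longrightarrow> v \<in> topspace L \<Longrightarrow> h v = g v"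
    unfolding extends_uniquely_def by blast
  have "continuous_map L E (fst \<circ> g)"
    using g(1) unfolding continuous_linear_operator_def
    by (meson continuous_map_compose continuous_map_fst)
  moreover have "linear_map_on (topspace L) (fst \<circ> g)"
    using g(1) unfolding continuous_linear_operator_def linear_map_on_def by simp
  ultimately have 1: "continuous_linear_operator L E (fst \<circ> g)"
    unfolding continuous_linear_operator_def by simp
  have 2: "\<forall>x\<in>topspace X. f x = (fst \<circ> g) (i x)"
  proof
    fix x assume "x \<in> topspace X"
    from arg_cong[OF g(2)[OF this], of fst] show "f x = (fst \<circ> g) (i x)" by simp
  qed
  have 3: "h v = (fst \<circ> g) v"
    if h: "continuous_linear_operator L E h" "\<forall>x\<in>topspace X. f x = h (i x)"
      and v: "v \<in> topspace L" for h v
  proof -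
    have "continuous_linear_operator L (prod_topology E ?Z) (\<lambda>v. (h v, 0))"
      using h(1) unfolding continuous_linear_operator_def linear_map_on_def
      by (auto intro!: continuous_map_pairedI)
    from un[OF this _ v] h(2) have "(h v, 0) = g v"
      by auto
    from arg_cong[OF this, of fst] show ?thesis
      by simp
  qed
  show ?thesis
    unfolding extends_uniquely_def using 1 2 3 by blast
qed

lemma free_lcs_span:
  fixes L :: "'l::real_vector topology"
  assumes free: "free_locally_convex_space X L i"
  shows "span (i ` topspace X) = topspace L"
proof
  have L: "locally_convex_space L" and ci: "continuous_map X L i"
    using free unfolding free_locally_convex_space_def by auto
  let ?M = "span (i ` topspace X)"
  have iL: "i ` topspace X \<subseteq> topspace L"
    using ci by (rule continuous_map_image_subset_topspace)
  show MsL: "?M \<subseteq> topspace L"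
    using span_minimal[OF iL lcsD(1)[OF L]] .
  let ?P = "pullback_topology ?M (\<lambda>x. x) L"
  have P: "locally_convex_space ?P"
    by (rule lcs_pullback[OF L]) (use MsL in \<open>auto simp: linear_map_on_def\<close>)
  have ciP: "continuous_map X ?P i"
    by (rule continuous_map_pullback') (use ci in \<open>auto simp: o_def span_base\<close>)
  have tP: "topspace ?P = ?M"
    using MsL by (auto simp: topspace_pullback_topology)
  have PL: "continuous_map ?P L (\<lambda>x. x)"
    using continuous_map_pullback[OF continuous_map_id, where f = "\<lambda>x. x" and A = ?M]
    by (simp add: o_def id_def)
  obtain h where h: "continuous_linear_operator L ?P h" "\<And>x. x \<in> topspace X \<Longrightarrow> i x = h (i x)"
    using free_lcs_extends'[OF free P ciP] unfolding extends_uniquely_def by blast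
  have hL: "continuous_linear_operator L L h"
    using continuous_map_compose[OF _ PL, of L h] h(1)
    unfolding continuous_linear_operator_def by (simp add: o_def)
  have idL: "continuous_linear_operator L L (\<lambda>x. x)"
    by (simp add: continuous_linear_operator_def linear_map_on_def)
  show "topspace L \<subseteq> ?M"
  proof
    fix v assume v: "v \<in> topspace L"
    obtain g where "\<And>h' v. continuous_linear_operator L L h' \<Longrightarrow> \<forall>x\<in>topspace X. i x = h' (i x) \<Longrightarrow>
        v \<in> topspace L \<Longrightarrow> h' v = g v"
      using free_lcs_extends'[OF free L ci] unfolding extends_uniquely_def by blast
    then have "h v = v"
      using hL idL h(2) v by (metis (no_types, lifting))
    moreover have "h v \<in> ?M"
      using h(1) v tP unfolding continuous_linear_operator_def continuous_map_def by auto
    ultimately show "v \<in> ?M" by simp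
  qed
qed

lemma Tychonoff_separate:
  assumes X: "Tychonoff_space X" and S: "finite S" "S \<subseteq> topspace X"
    and x: "x \<in> topspace X" "x \<notin> S"
  obtains \<phi> :: "'x \<Rightarrow> real" where "continuous_map X euclideanreal \<phi>" "\<phi> x = 1" "\<And>s. s \<in> S \<Longrightarrow> \<phi> s = 0"
proof -
  have "closedin X S"
    using X S by (simp add: Tychonoff_space_def closedin_Hausdorff_finite)
  then obtain f :: "'x \<Rightarrow> real" where f: "continuous_map X (top_of_set {0..1}) f" "f x = 0" "f ` S \<subseteq> {1}"
    using X x unfolding Tychonoff_space_def completely_regular_space_def by blast
  have "continuous_map X euclideanreal (\<lambda>x. 1 - f x)"
    using f(1) by (auto simp: continuous_map_in_subtopology intro!: continuous_intros)
  with f show ?thesis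
    by (intro that[of "\<lambda>x. 1 - f x"]) auto
qed

lemma free_lcs_basis:
  fixes L :: "'l::real_vector topology"
  assumes free: "free_locally_convex_space X L i" and X: "Tychonoff_space X"
  shows "inj_on i (topspace X)" and "independent (i ` topspace X)"
proof -
  have sp: "span (i ` topspace X) = topspace L"
    by (rule free_lcs_span[OF free])
  show inj: "inj_on i (topspace X)"
  proof (rule inj_onI, rule ccontr)
    fix x y assume xy: "x \<in> topspace X" "y \<in> topspace X" "i x = i y" "x \<noteq> y"
    obtain \<phi> :: "'a \<Rightarrow> real" where \<phi>: "continuous_map X euclideanreal \<phi>" "\<phi> x = 1" "\<phi> y = 0"
      using Tychonoff_separate[OF X, of "{y}" x] xy by auto
    show False
    proof (rule free_lcs_functional[OF free \<phi>(1)])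
      fix g assume "\<And>x. x \<in> topspace X \<Longrightarrow> g (i x) = \<phi> x"
      from this[of x] this[of y] show False using \<phi>(2,3) xy by simp
    qed
  qed
  show "independent (i ` topspace X)"
    unfolding dependent_def
  proof
    assume "\<exists>a\<in>i ` topspace X. a \<in> span (i ` topspace X - {a})"
    then obtain x where x: "x \<in> topspace X" "i x \<in> span (i ` topspace X - {i x})" by blast
    obtain T where T: "finite T" "T \<subseteq> i ` topspace X - {i x}" "i x \<in> span T"
    proof -
      obtain T r where T: "finite T" "T \<subseteq> i ` topspace X - {i x}" "i x = (\<Sum>a\<in>T. r a *\<^sub>R a)"
        using x(2) unfolding span_explicit by blast
      have "(\<Sum>a\<in>T. r a *\<^sub>R a) \<in> span T"
        by (intro span_sum span_scale span_base)
      then show ?thesis using T that by metis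
    qed
    obtain S where S: "S \<subseteq> topspace X" "finite S" "T = i ` S"
      using finite_subset_image[OF T(1), of i "topspace X"] T(2) by blast
    have "x \<notin> S" using S T by auto
    then obtain \<phi> :: "'a \<Rightarrow> real" where \<phi>: "continuous_map X euclideanreal \<phi>" "\<phi> x = 1"
        "\<And>s. s \<in> S \<Longrightarrow> \<phi> s = 0"
      using Tychonoff_separate[OF X S(2,1) x(1)] by metis
    obtain g where g: "continuous_linear_operator L euclideanreal g"
        "\<And>x. x \<in> topspace X \<Longrightarrow> g (i x) = \<phi> x"
      using free_lcs_functional[OF free \<phi>(1)] by blast
    have "span T \<subseteq> topspace L"
      using T(2) sp by (metis Diff_subset order_trans span_mono)
    then have "linear_map_on (span T) g"
      using g(1) unfolding continuous_linear_operator_def linear_map_on_def by blast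
    moreover have "linear_map_on (span T) (\<lambda>_. 0 :: real)"
      by (simp add: linear_map_on_def)
    ultimately have "g (i x) = 0"
    proof (rule linear_map_on_span_eq)
      show "g b = 0" if "b \<in> T" for b
        using that S g(2) \<phi>(3) by (metis imageE subsetD)
      show "i x \<in> span T" by (rule T(3))
    qed
    then show False using g(2) x(1) \<phi>(2) by simp
  qed
qed

theorem free_locally_convex_space_universal:
  fixes L :: "'l::real_vector topology" and E :: "'e::real_vector topology"
  assumes X: "Tychonoff_space X" and free: "free_locally_convex_space X L i"
    and E: "locally_convex_space E" and f: "continuous_map X E f"
  shows "extends_uniquely X L i E f"
proof -
  let ?B = "i ` topspace X"
  have L: "locally_convex_space L" and ci: "continuous_map X L i"
    using free unfolding free_locally_convex_space_def by auto
  have sp: "span ?B = topspace L"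
    by (rule free_lcs_span[OF free])
  note inj = free_lcs_basis(1)[OF free X]
  obtain g where g: "linear g" "\<And>b. b \<in> ?B \<Longrightarrow> g b = f (inv_into (topspace X) i b)"
    using linear_independent_extend[OF free_lcs_basis(2)[OF free X],
        of "\<lambda>b. f (inv_into (topspace X) i b)"] by blast
  have gi: "g (i x) = f x" if "x \<in> topspace X" for x
    using that g(2) inj by simp
  have glin: "linear_map_on S g" for S
    using g(1) by (simp add: linear_map_on_def linear_add linear_scale)
  have "g ` ?B \<subseteq> topspace E"
    using gi f by (auto simp: continuous_map_def)
  then have gE: "g ` topspace L \<subseteq> topspace E"
    using span_minimal[OF _ lcsD(1)[OF E]] linear_span_image[OF g(1), of ?B] sp by metis
  let ?G = "\<lambda>v. (v, g v)"
  let ?P = "pullback_topology (topspace L) ?G (prod_topology L E)"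
  have P: "locally_convex_space ?P"
    by (rule lcs_pullback[OF lcs_prod[OF L E] lcsD(1)[OF L]])
      (use gE glin in \<open>auto simp: linear_map_on_def inj_on_def\<close>)
  have cG: "continuous_map ?P (prod_topology L E) ?G"
    using continuous_map_pullback[OF continuous_map_id, where f = ?G and A = "topspace L"]
    by (simp add: o_def id_def)
  have PL: "continuous_map ?P L (\<lambda>v. v)" and PE: "continuous_map ?P E g"
    using continuous_map_compose[OF cG continuous_map_fst]
      continuous_map_compose[OF cG continuous_map_snd] by (simp_all add: o_def)
  have ciP: "continuous_map X ?P i"
  proof (rule continuous_map_pullback')
    have "continuous_map X (prod_topology L E) (\<lambda>x. (i x, f x))"
      using ci f by (intro continuous_map_pairedI)
    then show "continuous_map X (prod_topology L E) (?G \<circ> i)"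
      by (rule continuous_map_eq) (simp add: gi)
    show "topspace X \<subseteq> i -` topspace L"
      using ci by (auto simp: continuous_map_def)
  qed
  obtain h where h: "continuous_linear_operator L ?P h" "\<And>x. x \<in> topspace X \<Longrightarrow> i x = h (i x)"
    using free_lcs_extends'[OF free P ciP] unfolding extends_uniquely_def by blast
  have hv: "h v = v" if "v \<in> topspace L" for v
  proof (rule linear_map_on_span_eq[where B = ?B])
    show "linear_map_on (span ?B) h"
      using h(1) sp unfolding continuous_linear_operator_def by simp
    show "linear_map_on (span ?B) (\<lambda>v. v)"
      by (simp add: linear_map_on_def)
    show "h b = b" if "b \<in> ?B" for b
      using that h(2) by auto
    show "v \<in> span ?B" using that sp by simp
  qed
  have "continuous_map L E (g \<circ> h)"
    using h(1) PE unfolding continuous_linear_operator_def by (metis continuous_map_compose)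
  then have "continuous_map L E g"
    by (rule continuous_map_eq) (simp add: hv)
  then have cg: "continuous_linear_operator L E g"
    by (simp add: continuous_linear_operator_def glin)
  have un: "k v = g v"
    if k: "continuous_linear_operator L E k" "\<forall>x\<in>topspace X. f x = k (i x)"
      and v: "v \<in> topspace L" for k v
  proof (rule linear_map_on_span_eq[where B = ?B])
    show "linear_map_on (span ?B) k"
      using k(1) sp unfolding continuous_linear_operator_def by simp
    show "k b = g b" if b: "b \<in> ?B" for b
    proof -
      obtain x where "x \<in> topspace X" "b = i x" using b by blast
      then show ?thesis using k(2) gi[of x] by metis
    qed
    show "v \<in> span ?B" using v sp by simp
  qed (rule glin)
  have "\<forall>x\<in>topspace X. f x = g (i x)"
    using gi by metis
  then show ?thesis
    unfolding extends_uniquely_def using cg un by blast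
qed

end

theory Submission
  imports Defs
begin

text \<open>
  The reason for the Dunford--Pettis property is that \<open>L\<close> has very few convex weakly compact sets:
  each of them spans a finite-dimensional space. It is therefore compact for the original topology,
  and every continuous operator maps it to a compact set, which is closed because the range is
  Hausdorff.

  The image of \<open>X\<close> is a Hamel basis of \<open>L\<close>, so every vector has a finite support. The continuous
  functionals on \<open>L\<close> are the linear extensions of the continuous functions on \<open>X\<close>, and a Tychonoff
  space has enough of these for the size of the support to be lower semicontinuous in the weak
  topology (\<open>free_lcs_support_lower_semicontinuous\<close>): functions that peak at the points of a support
  and are nonzero on pairwise disjoint sets detect at least as many basis vectors in the support of
  every nearby vector.

  Let \<open>K\<close> be convex and weakly compact. It is the union of its weakly closed subsets of vectors with
  support of size at most \<open>n\<close>, so by Baire's theorem one of these has interior in \<open>K\<close>. Pulling the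
  points of \<open>K\<close> along segments into that interior bounds the support size on all of \<open>K\<close>. A vector
  of \<open>K\<close> whose support has maximal size then carries the supports of all the others
  (\<open>convex_bounded_support_finite_dim\<close>). On the resulting finite-dimensional span the coordinates
  are continuous functionals, so that the weak topology and the original one agree there.
\<close>

section \<open>Supports of vectors with respect to a Hamel basis\<close>

definition hamel_support :: "'a::real_vector set \<Rightarrow> 'a \<Rightarrow> 'a set" where
  "hamel_support B v = {b. representation B v b \<noteq> 0}"

lemma finite_hamel_support [simp]: "finite (hamel_support B v)"
  unfolding hamel_support_def by (rule finite_representation)

lemma hamel_support_subset: "hamel_support B v \<subseteq> B"
  unfolding hamel_support_def using representation_ne_zero by blast

lemma representation_segment:
  assumes "independent B" "u \<in> span B" "v \<in> span B"
  shows "representation B ((1 - t) *\<^sub>R u + t *\<^sub>R v) b =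
    (1 - t) * representation B u b + t * representation B v b"
  using assms by (simp add: representation_add representation_scale span_scale)

lemma in_span_hamel_support:
  assumes "independent B" "v \<in> span B" "hamel_support B v \<subseteq> S"
  shows "v \<in> span S"
proof -
  have "(\<Sum>b\<in>hamel_support B v. representation B v b *\<^sub>R b) \<in> span S"
    using assms(3) by (intro span_sum span_scale span_base) auto
  then show ?thesis
    using sum_nonzero_representation_eq[OF assms(1,2)] by (simp add: hamel_support_def)
qed

lemma linear_map_on_sum:
  assumes "linear_map_on (span B) g" "finite S" "S \<subseteq> B"
  shows "g (\<Sum>b\<in>S. c b *\<^sub>R b) = (\<Sum>b\<in>S. c b *\<^sub>R g b)"
  using assms(2,3)
proof (induction S rule: finite_induct)
  case empty
  show ?case using assms(1) unfolding linear_map_on_def by (metis scaleR_zero_left span_zero sum.empty)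
next
  case (insert x F)
  have "x \<in> span B" "(\<Sum>b\<in>F. c b *\<^sub>R b) \<in> span B"
    using insert.prems by (auto intro: span_base intro!: span_sum span_scale)
  then show ?case
    using insert assms(1) by (simp add: linear_map_on_def span_scale)
qed

lemma linear_map_on_hamel_support:
  fixes g :: "'a::real_vector \<Rightarrow> 'b::real_vector"
  assumes "independent B" "v \<in> span B" "linear_map_on (span B) g"
  shows "g v = (\<Sum>b\<in>hamel_support B v. representation B v b *\<^sub>R g b)"
  using linear_map_on_sum[OF assms(3) finite_hamel_support[of B v] hamel_support_subset,
      of "representation B v"]
    sum_nonzero_representation_eq[OF assms(1,2)]
  by (simp add: hamel_support_def)

text \<open>
  A point of \<open>K\<close> with a support of maximal size must already carry the supports of all other points:
  on the segment from it to another point, all but finitely many points have as support the union of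
  the two supports.
\<close>

lemma convex_bounded_support_finite_dim:
  assumes B: "independent B" and K: "convex K" "K \<subseteq> span B"
    and bd: "\<And>v. v \<in> K \<Longrightarrow> card (hamel_support B v) \<le> n"
  obtains S where "finite S" "S \<subseteq> B" "K \<subseteq> span S"
proof (cases "K = {}")
  case True
  then show ?thesis using that[of "{}"] by simp
next
  case False
  then obtain u where u: "u \<in> K"
    and max: "\<And>v. v \<in> K \<Longrightarrow> card (hamel_support B v) \<le> card (hamel_support B u)"
    using ex_has_greatest_nat[of "\<lambda>v. v \<in> K" _ "\<lambda>v. card (hamel_support B v)" "Suc n"] bd
    by (metis all_not_in_conv le_imp_less_Suc)
  have "v \<in> span (hamel_support B u)" if v: "v \<in> K" for v
  proof (rule in_span_hamel_support[OF B])
    show "v \<in> span B" using v K by blast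
    show "hamel_support B v \<subseteq> hamel_support B u"
    proof (rule ccontr)
      assume "\<not> ?thesis"
      then obtain c where c: "c \<in> hamel_support B v" "c \<notin> hamel_support B u" by blast
      let ?a = "representation B u" and ?d = "representation B v"
      \<comment> \<open>the parameters at which the coefficient of some basis vector \<open>b\<close> in the support of \<open>u\<close>
        vanishes on the segment\<close>
      let ?bad = "(\<lambda>b. ?a b / (?a b - ?d b)) ` hamel_support B u"
      have "infinite ({0<..<1::real} - ?bad)"
        by (intro Diff_infinite_finite) (auto simp: infinite_Ioo)
      then have "{0<..<1} - ?bad \<noteq> {}"
        using finite.emptyI by metis
      then obtain t where t: "0 < t" "t < 1" "t \<notin> ?bad"
        unfolding ex_in_conv[symmetric] Diff_iff greaterThanLessThan_iff by blast
      let ?w = "(1 - t) *\<^sub>R u + t *\<^sub>R v"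
      have w: "?w \<in> K"
        using convexD_alt[OF K(1) u v, of t] t by simp
      have rw: "representation B ?w b = (1 - t) * ?a b + t * ?d b" for b
        using representation_segment[OF B] u v K by blast
      have "insert c (hamel_support B u) \<subseteq> hamel_support B ?w"
      proof
        fix b assume "b \<in> insert c (hamel_support B u)"
        then consider "b = c" | "b \<in> hamel_support B u" by blast
        then show "b \<in> hamel_support B ?w"
        proof cases
          case 1
          then show ?thesis using c t unfolding hamel_support_def by (simp add: rw)
        next
          case 2
          then have ne: "t \<noteq> ?a b / (?a b - ?d b)" "?a b \<noteq> 0"
            using t(3) by (auto simp: hamel_support_def)
          have "(1 - t) * ?a b + t * ?d b \<noteq> 0"
          proof
            assume "(1 - t) * ?a b + t * ?d b = 0"
            then have eq: "t * (?a b - ?d b) = ?a b" by (simp add: algebra_simps)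
            then have "?a b - ?d b \<noteq> 0" using ne(2) by auto
            then show False using eq ne(1) by (simp add: field_simps)
          qed
          then show ?thesis unfolding hamel_support_def by (simp add: rw)
        qed
      qed
      then have "card (insert c (hamel_support B u)) \<le> card (hamel_support B ?w)"
        by (intro card_mono) auto
      then show False
        using c(2) max[OF w] by simp
    qed
  qed
  then show ?thesis
    by (intro that[OF finite_hamel_support hamel_support_subset]) blast
qed

section \<open>The weak topology\<close>

lemma topspace_weak_topology [simp]: "topspace (weak_topology E) = topspace E"
proof -
  have "continuous_linear_operator E euclideanreal (\<lambda>_. 0)"
    by (simp add: continuous_linear_operator_def linear_map_on_def)
  then have "topspace E \<in> {{x \<in> topspace E. \<phi> x \<in> U} | \<phi> U.
      continuous_linear_operator E euclideanreal \<phi> \<and> open U}"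
    by (auto intro!: exI[of _ "\<lambda>_. 0"] exI[of _ UNIV])
  then show ?thesis
    unfolding weak_topology_def by auto
qed

lemma continuous_map_weak_topology_functional:
  assumes "continuous_linear_operator E euclideanreal \<phi>"
  shows "continuous_map (weak_topology E) euclideanreal \<phi>"
  unfolding continuous_map_def
proof (intro conjI allI impI)
  fix U :: "real set" assume "openin euclideanreal U"
  then show "openin (weak_topology E) {x \<in> topspace (weak_topology E). \<phi> x \<in> U}"
    using assms unfolding topspace_weak_topology
    by (subst weak_topology_def, intro topology_generated_by_Basis) auto
qed auto

lemma continuous_map_into_weak_topology:
  assumes "\<And>\<phi>. continuous_linear_operator E euclideanreal \<phi> \<Longrightarrow>
      continuous_map Y euclideanreal (\<lambda>y. \<phi> (f y))"
    and "f ` topspace Y \<subseteq> topspace E"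
  shows "continuous_map Y (weak_topology E) f"
  unfolding weak_topology_def
proof (rule continuous_on_generated_topo)
  fix W assume "W \<in> {{x \<in> topspace E. \<phi> x \<in> U} | \<phi> U.
      continuous_linear_operator E euclideanreal \<phi> \<and> open U}"
  then obtain \<phi> U where W: "W = {x \<in> topspace E. \<phi> x \<in> U}"
    "continuous_linear_operator E euclideanreal \<phi>" "open U" by blast
  have "f -` W \<inter> topspace Y = {y \<in> topspace Y. \<phi> (f y) \<in> U}"
    using assms(2) W(1) by auto
  then show "openin Y (f -` W \<inter> topspace Y)"
    using openin_continuous_map_preimage[OF assms(1)[OF W(2)]] W(3) by simp
next
  show "f ` topspace Y \<subseteq> \<Union> {{x \<in> topspace E. \<phi> x \<in> U} | \<phi> U.
      continuous_linear_operator E euclideanreal \<phi> \<and> open U}"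
    using assms(2) topspace_weak_topology[of E] unfolding weak_topology_def by simp
qed

lemma continuous_map_segment_weak_topology:
  assumes E: "subspace (topspace E)" and uv: "u \<in> topspace E" "v \<in> topspace E"
  shows "continuous_map euclideanreal (weak_topology E) (\<lambda>t. (1 - t) *\<^sub>R u + t *\<^sub>R v)"
proof (rule continuous_map_into_weak_topology)
  fix \<phi> assume "continuous_linear_operator E euclideanreal \<phi>"
  then have "\<phi> ((1 - t) *\<^sub>R u + t *\<^sub>R v) = (1 - t) * \<phi> u + t * \<phi> v" for t
    using uv E unfolding continuous_linear_operator_def linear_map_on_def
    by (simp add: subspace_scale)
  then show "continuous_map euclideanreal euclideanreal (\<lambda>t. \<phi> ((1 - t) *\<^sub>R u + t *\<^sub>R v))"
    by (auto intro!: continuous_intros)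
next
  show "(\<lambda>t. (1 - t) *\<^sub>R u + t *\<^sub>R v) ` topspace euclideanreal \<subseteq> topspace E"
    using E uv by (auto intro!: subspace_add subspace_scale)
qed

lemma lcs_continuous_map_add:
  assumes "locally_convex_space E" "continuous_map Y E f" "continuous_map Y E g"
  shows "continuous_map Y E (\<lambda>y. f y + g y)"
  using continuous_map_compose[OF continuous_map_pairedI[OF assms(2,3)] lcsD(2)[OF assms(1)]]
  by (simp add: o_def)

lemma lcs_continuous_map_scaleR:
  assumes "locally_convex_space E" "continuous_map Y euclideanreal c" "continuous_map Y E f"
  shows "continuous_map Y E (\<lambda>y. c y *\<^sub>R f y)"
  using continuous_map_compose[OF continuous_map_pairedI[OF assms(2,3)] lcsD(3)[OF assms(1)]]
  by (simp add: o_def)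

lemma lcs_continuous_map_sum:
  assumes E: "locally_convex_space E" and "finite S"
    and "\<And>s. s \<in> S \<Longrightarrow> continuous_map Y E (f s)"
  shows "continuous_map Y E (\<lambda>y. \<Sum>s\<in>S. f s y)"
  using assms(2,3)
proof (induction S rule: finite_induct)
  case empty
  show ?case using subspace_0[OF lcsD(1)[OF E]] by simp
next
  case (insert s S)
  then show ?case by (simp add: lcs_continuous_map_add[OF E])
qed

section \<open>Functionals on the free locally convex space\<close>

text \<open>
  Subtracting from a function that peaks at \<open>s\<close> the absolute values of those that peak at the other
  points, and taking the positive part, makes the functions disjoint: where two of them were
  positive, each of the two original functions would exceed the other.
\<close>

lemma Tychonoff_disjoint_functions:
  fixes X :: "'x topology"
  assumes X: "Tychonoff_space X" and S: "finite S" "S \<subseteq> topspace X"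
  obtains \<psi> :: "'x \<Rightarrow> 'x \<Rightarrow> real" where
    "\<forall>s\<in>S. continuous_map X euclideanreal (\<psi> s) \<and> \<psi> s s = 1"
    "\<forall>s\<in>S. \<forall>t\<in>S. s \<noteq> t \<longrightarrow> (\<forall>x. \<psi> s x = 0 \<or> \<psi> t x = 0)"
proof -
  have "\<exists>f :: 'x \<Rightarrow> real. continuous_map X euclideanreal f \<and> f s = 1 \<and> (\<forall>t\<in>S - {s}. f t = 0)"
    if "s \<in> S" for s
    using Tychonoff_separate[OF X, of "S - {s}" s] S that
    by (metis (no_types, lifting) Diff_iff Diff_subset finite_Diff insertI1 subset_iff)
  then obtain f :: "'x \<Rightarrow> 'x \<Rightarrow> real" where f: "\<And>s. s \<in> S \<Longrightarrow> continuous_map X euclideanreal (f s)"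
      "\<And>s. s \<in> S \<Longrightarrow> f s s = 1" "\<And>s t. s \<in> S \<Longrightarrow> t \<in> S \<Longrightarrow> s \<noteq> t \<Longrightarrow> f s t = 0"
    by (metis DiffI singletonD)
  define \<psi> where "\<psi> s x = max 0 (f s x - (\<Sum>t\<in>S - {s}. \<bar>f t x\<bar>))" for s x
  have sum0: "(\<Sum>t\<in>S - {s}. \<bar>f t s\<bar>) = 0" if "s \<in> S" for s
    using f(3) that by (intro sum.neutral) auto
  have dom: "\<psi> s x = 0 \<or> \<bar>f t x\<bar> < f s x" if "t \<in> S" "s \<noteq> t" for s t x
  proof -
    have "\<bar>f t x\<bar> \<le> (\<Sum>t\<in>S - {s}. \<bar>f t x\<bar>)"
      using S that by (intro member_le_sum) auto
    then show ?thesis unfolding \<psi>_def by linarith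
  qed
  have cont: "continuous_map X euclideanreal (\<psi> s)" if "s \<in> S" for s
    unfolding \<psi>_def using f(1) S that by (intro continuous_intros) auto
  have one: "\<psi> s s = 1" if "s \<in> S" for s
    unfolding \<psi>_def using f(2) sum0 that by simp
  have disj: "\<psi> s x = 0 \<or> \<psi> t x = 0" if "s \<in> S" "t \<in> S" "s \<noteq> t" for s t x
    using dom[of t s x] dom[of s t x] that by force
  show ?thesis
    by (rule that[of \<psi>]) (use cont one disj in auto)
qed

text \<open>
  Orthogonality on \<open>S\<close> is a consequence of disjointness, because \<open>\<gamma> t\<close> does not vanish at \<open>t\<close>. It
  makes the functionals \<open>\<gamma> s\<close> the coordinates on the span of \<open>S\<close>.
\<close>

lemma free_lcs_disjoint_functionals:
  fixes L :: "'l::real_vector topology"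
  assumes X: "Tychonoff_space X" and free: "free_locally_convex_space X L i"
    and S: "finite S" "S \<subseteq> i ` topspace X"
  obtains \<gamma> :: "'l \<Rightarrow> 'l \<Rightarrow> real" where
    "\<forall>s\<in>S. continuous_linear_operator L euclideanreal (\<gamma> s) \<and> \<gamma> s s = 1 \<and> (\<forall>t\<in>S - {s}. \<gamma> s t = 0)"
    "\<forall>s\<in>S. \<forall>t\<in>S. s \<noteq> t \<longrightarrow> (\<forall>b\<in>i ` topspace X. \<gamma> s b = 0 \<or> \<gamma> t b = 0)"
proof -
  let ?j = "inv_into (topspace X) i"
  have j: "?j s \<in> topspace X" "i (?j s) = s" if "s \<in> S" for s
    using S that by (auto simp: inv_into_into f_inv_into_f)
  have jj: "?j s \<noteq> ?j t" if "s \<in> S" "t \<in> S" "s \<noteq> t" for s t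
    using j that by metis
  have fin: "finite (?j ` S)" "?j ` S \<subseteq> topspace X"
    using S j by auto
  obtain \<psi> :: "_ \<Rightarrow> _ \<Rightarrow> real" where \<psi>:
    "\<forall>s\<in>?j ` S. continuous_map X euclideanreal (\<psi> s) \<and> \<psi> s s = 1"
    "\<forall>s\<in>?j ` S. \<forall>t\<in>?j ` S. s \<noteq> t \<longrightarrow> (\<forall>x. \<psi> s x = 0 \<or> \<psi> t x = 0)"
    by (rule Tychonoff_disjoint_functions[OF X fin])
  have "\<exists>g. continuous_linear_operator L euclideanreal g \<and> (\<forall>x\<in>topspace X. g (i x) = \<psi> (?j s) x)"
    if "s \<in> S" for s
  proof -
    have "continuous_map X euclideanreal (\<psi> (?j s))" using \<psi>(1) that by blast
    then show ?thesis using free_lcs_functional[OF free] by metis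
  qed
  then obtain \<gamma> where \<gamma>: "\<And>s. s \<in> S \<Longrightarrow> continuous_linear_operator L euclideanreal (\<gamma> s)"
      "\<And>s x. s \<in> S \<Longrightarrow> x \<in> topspace X \<Longrightarrow> \<gamma> s (i x) = \<psi> (?j s) x"
    by metis
  have one: "\<gamma> s s = 1" if "s \<in> S" for s
    using \<gamma>(2)[OF that j(1)[OF that]] j(2)[OF that] \<psi>(1) that by simp
  have disj: "\<gamma> s b = 0 \<or> \<gamma> t b = 0" 
    if st: "s \<in> S" "t \<in> S" "s \<noteq> t" and b: "b \<in> i ` topspace X" for s t b
  proof -
    obtain x where x: "x \<in> topspace X" "b = i x" using b by blast
    have "\<psi> (?j s) x = 0 \<or> \<psi> (?j t) x = 0"
      using \<psi>(2) jj[OF st] st(1,2) by blast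
    then show ?thesis using \<gamma>(2) x st(1,2) by simp
  qed
  have orth: "\<gamma> s t = 0" if "s \<in> S" "t \<in> S - {s}" for s t
  proof -
    have "t \<in> i ` topspace X" using S(2) that by blast
    then show ?thesis using disj[of s t t] one[of t] that by auto
  qed
  show ?thesis
    by (rule that[of \<gamma>]) (use \<gamma>(1) one disj orth in auto)
qed

lemma free_lcs_functional_eq_sum:
  fixes L :: "'l::real_vector topology" and g :: "'l \<Rightarrow> real"
  assumes X: "Tychonoff_space X" and free: "free_locally_convex_space X L i"
    and g: "continuous_linear_operator L euclideanreal g" and v: "v \<in> topspace L"
  shows "g v = (\<Sum>b\<in>hamel_support (i ` topspace X) v. representation (i ` topspace X) v b * g b)"
  using linear_map_on_hamel_support[OF free_lcs_basis(2)[OF free X], of v g] g v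
    free_lcs_span[OF free]
  by (simp add: continuous_linear_operator_def)

lemma free_lcs_functional_eq_coordinate:
  fixes L :: "'l::real_vector topology" and g :: "'l \<Rightarrow> real"
  assumes X: "Tychonoff_space X" and free: "free_locally_convex_space X L i"
    and g: "continuous_linear_operator L euclideanreal g" and v: "v \<in> topspace L"
    and s: "s \<in> hamel_support (i ` topspace X) v" "g s = 1"
    and orth: "\<And>t. t \<in> hamel_support (i ` topspace X) v \<Longrightarrow> t \<noteq> s \<Longrightarrow> g t = 0"
  shows "g v = representation (i ` topspace X) v s"
proof -
  let ?B = "i ` topspace X"
  have "g v = (\<Sum>b\<in>hamel_support ?B v. representation ?B v b * g b)"
    by (rule free_lcs_functional_eq_sum[OF X free g v])
  also have "\<dots> = (\<Sum>b\<in>{s}. representation ?B v b * g b)"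
    using s(1) orth by (intro sum.mono_neutral_right) auto
  finally show ?thesis using s(2) by simp
qed

text \<open>
  The disjoint functionals attached to the support of \<open>v\<close> are all nonzero at \<open>v\<close>. Where they are
  nonzero at \<open>w\<close>, each of them detects a different basis vector in the support of \<open>w\<close>.
\<close>

lemma free_lcs_support_lower_semicontinuous:
  fixes L :: "'l::real_vector topology"
  assumes X: "Tychonoff_space X" and free: "free_locally_convex_space X L i"
    and v: "v \<in> topspace L"
  obtains W where "openin (weak_topology L) W" "v \<in> W"
    "\<And>w. w \<in> W \<Longrightarrow>
      card (hamel_support (i ` topspace X) v) \<le> card (hamel_support (i ` topspace X) w)"
proof -
  let ?B = "i ` topspace X"
  let ?S = "hamel_support ?B v"
  obtain \<gamma> :: "'l \<Rightarrow> 'l \<Rightarrow> real" where disj: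
    "\<forall>s\<in>?S. continuous_linear_operator L euclideanreal (\<gamma> s) \<and> \<gamma> s s = 1 \<and> (\<forall>t\<in>?S - {s}. \<gamma> s t = 0)"
    "\<forall>s\<in>?S. \<forall>t\<in>?S. s \<noteq> t \<longrightarrow> (\<forall>b\<in>i ` topspace X. \<gamma> s b = 0 \<or> \<gamma> t b = 0)"
    by (rule free_lcs_disjoint_functionals[OF X free finite_hamel_support hamel_support_subset])
  have \<gamma>: "continuous_linear_operator L euclideanreal (\<gamma> s)" "\<gamma> s s = 1"
      "\<And>t. t \<in> ?S \<Longrightarrow> t \<noteq> s \<Longrightarrow> \<gamma> s t = 0" if "s \<in> ?S" for s
    using disj(1) that by auto
  define W where "W = topspace L \<inter> (\<Inter>s\<in>?S. {w \<in> topspace L. \<gamma> s w \<in> - {0}})"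
  have "openin (weak_topology L) W"
  proof (cases "?S = {}")
    case True
    then show ?thesis
      unfolding W_def using openin_topspace[of "weak_topology L"] by simp
  next
    case False
    have "openin (weak_topology L) {w \<in> topspace L. \<gamma> s w \<in> - {0}}" if "s \<in> ?S" for s
      using openin_continuous_map_preimage[OF
          continuous_map_weak_topology_functional[OF \<gamma>(1)[OF that]], of "- {0}"] by auto
    then show ?thesis
      unfolding W_def using openin_topspace[of "weak_topology L"] False
      by (intro openin_Int openin_INT2) auto
  qed
  moreover have "v \<in> W"
  proof -
    have "\<gamma> s v \<noteq> 0" if s: "s \<in> ?S" for s
      using free_lcs_functional_eq_coordinate[OF X free \<gamma>(1)[OF s] v s \<gamma>(2)[OF s] \<gamma>(3)[OF s]] s
      by (simp add: hamel_support_def)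
    then show ?thesis unfolding W_def using v by auto
  qed
  moreover have "card ?S \<le> card (hamel_support ?B w)" if w: "w \<in> W" for w
  proof -
    have "\<exists>b. b \<in> hamel_support ?B w \<and> \<gamma> s b \<noteq> 0" if s: "s \<in> ?S" for s
    proof (rule ccontr)
      assume "\<not> ?thesis"
      then have "\<gamma> s w = 0"
        using free_lcs_functional_eq_sum[OF X free \<gamma>(1)[OF s], of w] w unfolding W_def
        by (auto intro!: sum.neutral)
      then show False using w s unfolding W_def by auto
    qed
    then obtain h where h: "\<And>s. s \<in> ?S \<Longrightarrow> h s \<in> hamel_support ?B w \<and> \<gamma> s (h s) \<noteq> 0"
      by metis
    have "inj_on h ?S"
    proof (intro inj_onI, rule ccontr)
      fix s t assume st: "s \<in> ?S" "t \<in> ?S" "h s = h t" "s \<noteq> t"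
      have "h s \<in> ?B" using h[OF st(1)] hamel_support_subset by blast
      then have "\<gamma> s (h s) = 0 \<or> \<gamma> t (h s) = 0" using disj(2) st by blast
      then show False using h[OF st(1)] h[OF st(2)] st(3) by simp
    qed
    then show ?thesis
      using h by (intro card_inj_on_le[of h]) auto
  qed
  ultimately show ?thesis using that by blast
qed

lemma closedin_weak_topology_support_le:
  fixes L :: "'l::real_vector topology"
  assumes X: "Tychonoff_space X" and free: "free_locally_convex_space X L i"
  shows "closedin (weak_topology L) {v \<in> topspace L. card (hamel_support (i ` topspace X) v) \<le> n}"
    (is "closedin _ ?C")
  unfolding closedin_def topspace_weak_topology
proof (intro conjI)
  show "openin (weak_topology L) (topspace L - ?C)"
  proof (subst openin_subopen, intro ballI)
    fix v assume v: "v \<in> topspace L - ?C"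
    obtain W where W: "openin (weak_topology L) W" "v \<in> W"
      "\<And>w. w \<in> W \<Longrightarrow>
        card (hamel_support (i ` topspace X) v) \<le> card (hamel_support (i ` topspace X) w)"
      using free_lcs_support_lower_semicontinuous[OF X free, of v] v by blast
    have "W \<subseteq> topspace L - ?C"
      using W(3) v openin_subset[OF W(1)] by fastforce
    then show "\<exists>T. openin (weak_topology L) T \<and> v \<in> T \<and> T \<subseteq> topspace L - ?C"
      using W by blast
  qed
qed auto

lemma Hausdorff_weak_topology_free_lcs:
  fixes L :: "'l::real_vector topology"
  assumes X: "Tychonoff_space X" and free: "free_locally_convex_space X L i"
  shows "Hausdorff_space (weak_topology L)"
  unfolding Hausdorff_space_def topspace_weak_topology
proof (intro allI impI)
  fix u v assume uv: "u \<in> topspace L \<and> v \<in> topspace L \<and> u \<noteq> v"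
  let ?B = "i ` topspace X"
  have sub: "subspace (topspace L)"
    using free lcsD(1) unfolding free_locally_convex_space_def by blast
  have d: "u - v \<in> topspace L" using sub uv by (simp add: subspace_diff)
  let ?S = "hamel_support ?B (u - v)"
  have "?S \<noteq> {}"
    using in_span_hamel_support[OF free_lcs_basis(2)[OF free X], of "u - v" "{}"] d uv
      free_lcs_span[OF free] by auto
  then obtain s where s: "s \<in> ?S" by blast
  obtain \<gamma> :: "'l \<Rightarrow> 'l \<Rightarrow> real" where disj:
    "\<forall>s\<in>?S. continuous_linear_operator L euclideanreal (\<gamma> s) \<and> \<gamma> s s = 1 \<and> (\<forall>t\<in>?S - {s}. \<gamma> s t = 0)"
    "\<forall>s\<in>?S. \<forall>t\<in>?S. s \<noteq> t \<longrightarrow> (\<forall>b\<in>i ` topspace X. \<gamma> s b = 0 \<or> \<gamma> t b = 0)"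
    by (rule free_lcs_disjoint_functionals[OF X free finite_hamel_support hamel_support_subset])
  have \<gamma>: "continuous_linear_operator L euclideanreal (\<gamma> s)" "\<gamma> s s = 1"
      "\<And>t. t \<in> ?S \<Longrightarrow> t \<noteq> s \<Longrightarrow> \<gamma> s t = 0" if "s \<in> ?S" for s
    using disj(1) that by auto
  have "\<gamma> s (u - v) \<noteq> 0"
    using free_lcs_functional_eq_coordinate[OF X free \<gamma>(1)[OF s] d s \<gamma>(2)[OF s] \<gamma>(3)[OF s]] s
    by (simp add: hamel_support_def)
  moreover have "\<gamma> s ((u - v) + v) = \<gamma> s (u - v) + \<gamma> s v"
    using \<gamma>(1)[OF s] d uv unfolding continuous_linear_operator_def linear_map_on_def by blast
  ultimately have "\<gamma> s u \<noteq> \<gamma> s v" by simp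
  then obtain P Q where PQ: "open P" "open Q" "\<gamma> s u \<in> P" "\<gamma> s v \<in> Q" "P \<inter> Q = {}"
    using hausdorff by metis
  have op: "openin (weak_topology L) {w \<in> topspace L. \<gamma> s w \<in> R}" if "open R" for R
    using openin_continuous_map_preimage[OF
        continuous_map_weak_topology_functional[OF \<gamma>(1)[OF s]], of R] that by auto
  show "\<exists>U V. openin (weak_topology L) U \<and> openin (weak_topology L) V \<and> u \<in> U \<and> v \<in> V \<and> disjnt U V"
    using op[OF PQ(1)] op[OF PQ(2)] PQ(3-5) uv
    by (intro exI[of _ "{w \<in> topspace L. \<gamma> s w \<in> P}"] exI[of _ "{w \<in> topspace L. \<gamma> s w \<in> Q}"])
      (auto simp: disjnt_def)
qed

section \<open>Weakly compact convex sets are finite-dimensional\<close>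

text \<open>
  Baire's theorem for the compact Hausdorff space \<open>K\<close> gives \<open>n\<close> and a point \<open>u\<close> such that all points
  of \<open>K\<close> near \<open>u\<close> have support size at most \<open>n\<close>. For every \<open>v\<close> in \<open>K\<close> this applies to
  \<open>(1 - t) *\<^sub>R u + t *\<^sub>R v\<close> with a small \<open>t > 0\<close>, and solving for \<open>v\<close> shows that the support of
  \<open>v\<close> has size at most \<open>2 * n\<close>.
\<close>

lemma weakly_compact_convex_finite_dim:
  fixes L :: "'l::real_vector topology"
  assumes X: "Tychonoff_space X" and free: "free_locally_convex_space X L i"
    and K: "convex K" "compactin (weak_topology L) K"
  obtains S where "finite S" "S \<subseteq> i ` topspace X" "K \<subseteq> span S"
proof (cases "K = {}")
  case True
  then show ?thesis using that[of "{}"] by simp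
next
  case False
  let ?B = "i ` topspace X"
  let ?W = "weak_topology L"
  let ?K = "subtopology ?W K"
  let ?E = "\<lambda>n. {v \<in> topspace L. card (hamel_support ?B v) \<le> n}"
  have KL: "K \<subseteq> topspace L"
    using compactin_subset_topspace[OF K(2)] by simp
  then have tK: "topspace ?K = K" by auto
  have sub: "subspace (topspace L)"
    using free lcsD(1) unfolding free_locally_convex_space_def by blast
  have ind: "independent ?B" and sp: "span ?B = topspace L"
    using free_lcs_basis(2)[OF free X] free_lcs_span[OF free] by auto
  have cK: "compact_space ?K"
    using K(2) by (simp add: compact_space_subtopology)
  have hK: "Hausdorff_space ?K"
    by (intro Hausdorff_space_subtopology Hausdorff_weak_topology_free_lcs[OF X free])
  have "\<exists>n. ?K interior_of (K \<inter> ?E n) \<noteq> {}"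
  proof (rule ccontr)
    assume "\<not> ?thesis"
    then have "?K interior_of (\<Union>(range (\<lambda>n. K \<inter> ?E n))) = {}"
      using closedin_weak_topology_support_le[OF X free]
      by (intro Baire_category_alt disjI2 conjI compact_imp_locally_compact_space
          compact_Hausdorff_imp_regular_space cK hK)
        (auto simp: closedin_subtopology_Int_closed)
    moreover have "\<Union>(range (\<lambda>n. K \<inter> ?E n)) = K"
      using KL by auto
    ultimately show False
      using False interior_of_topspace[of ?K] tK by simp
  qed
  then obtain n V u where V: "openin ?K V" "V \<subseteq> ?E n" "u \<in> V"
    unfolding interior_of_eq_empty by (metis (lifting) ex_in_conv inf.boundedE)
  have uK: "u \<in> K" using openin_subset[OF V(1)] V(3) tK by blast
  have "card (hamel_support ?B v) \<le> 2 * n" if v: "v \<in> K" for v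
  proof -
    let ?s = "\<lambda>t. (1 - t) *\<^sub>R u + t *\<^sub>R v"
    have sK: "?s t \<in> K" if "t \<in> {0..1}" for t
      using convexD_alt[OF K(1) uK v, of t] that by simp
    have "continuous_map euclideanreal ?W ?s"
      using continuous_map_segment_weak_topology[OF sub] uK v KL by blast
    then have cs: "continuous_map (top_of_set {0..1}) ?K ?s"
      using sK by (auto simp: continuous_map_in_subtopology intro: continuous_map_from_subtopology)
    have "openin (top_of_set {0..1}) {t \<in> {0..1}. ?s t \<in> V}"
      using openin_continuous_map_preimage[OF cs V(1)] by simp
    moreover have "(0::real) \<in> {t \<in> {0..1}. ?s t \<in> V}"
      using V(3) by simp
    ultimately obtain e where e: "e > 0" "ball 0 e \<inter> {0..1} \<subseteq> {t \<in> {0..1::real}. ?s t \<in> V}"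
      unfolding openin_contains_ball by blast
    define t where "t = min 1 (e / 2)"
    have "t \<in> ball 0 e \<inter> {0..1}"
      using e(1) unfolding t_def by (auto simp: min_def)
    then have t: "?s t \<in> V"
      using e(2) by blast
    have t0: "0 < t"
      using e(1) unfolding t_def by simp
    have "hamel_support ?B v \<subseteq> hamel_support ?B (?s t) \<union> hamel_support ?B u"
    proof -
      have "representation ?B (?s t) b = (1 - t) * representation ?B u b + t * representation ?B v b"
        for b
        using representation_segment[OF ind] uK v KL sp by blast
      then show ?thesis using t0 by (auto simp: hamel_support_def)
    qed
    then have "card (hamel_support ?B v) \<le> card (hamel_support ?B (?s t) \<union> hamel_support ?B u)"
      by (intro card_mono) auto
    also have "\<dots> \<le> card (hamel_support ?B (?s t)) + card (hamel_support ?B u)"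
      by (rule card_Un_le)
    also have "\<dots> \<le> 2 * n"
      using subsetD[OF V(2) V(3)] subsetD[OF V(2) t] by simp
    finally show ?thesis .
  qed
  from convex_bounded_support_finite_dim[OF ind K(1) _ this] show ?thesis
    using KL sp that by blast
qed

text \<open>
  On \<open>K\<close> the identity is a finite sum of weakly continuous coordinate functionals times fixed
  vectors, hence continuous from the weak to the original topology.
\<close>

lemma weakly_compact_convex_imp_compact:
  fixes L :: "'l::real_vector topology"
  assumes X: "Tychonoff_space X" and free: "free_locally_convex_space X L i"
    and K: "convex K" "compactin (weak_topology L) K"
  shows "compactin L K"
proof -
  have L: "locally_convex_space L"
    using free unfolding free_locally_convex_space_def by blast
  let ?K = "subtopology (weak_topology L) K"
  obtain S where S: "finite S" "S \<subseteq> i ` topspace X" "K \<subseteq> span S"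
    using weakly_compact_convex_finite_dim[OF X free K] by blast
  have SL: "span S \<subseteq> topspace L"
    using span_mono[OF S(2)] free_lcs_span[OF free] by simp
  obtain \<gamma> :: "'l \<Rightarrow> 'l \<Rightarrow> real" where disj:
    "\<forall>s\<in>S. continuous_linear_operator L euclideanreal (\<gamma> s) \<and> \<gamma> s s = 1 \<and> (\<forall>t\<in>S - {s}. \<gamma> s t = 0)"
    "\<forall>s\<in>S. \<forall>t\<in>S. s \<noteq> t \<longrightarrow> (\<forall>b\<in>i ` topspace X. \<gamma> s b = 0 \<or> \<gamma> t b = 0)"
    by (rule free_lcs_disjoint_functionals[OF X free S(1,2)])
  have \<gamma>: "continuous_linear_operator L euclideanreal (\<gamma> s)" "\<gamma> s s = 1"
      "\<And>t. t \<in> S \<Longrightarrow> t \<noteq> s \<Longrightarrow> \<gamma> s t = 0" if "s \<in> S" for s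
    using disj(1) that by auto
  have expand: "(\<Sum>s\<in>S. \<gamma> s v *\<^sub>R s) = v" if "v \<in> span S" for v
  proof (rule linear_map_on_span_eq[where B = S])
    show "linear_map_on (span S) (\<lambda>v. \<Sum>s\<in>S. \<gamma> s v *\<^sub>R s)"
      using \<gamma>(1) SL unfolding continuous_linear_operator_def linear_map_on_def
      by (auto simp: subset_iff scaleR_add_left sum.distrib scaleR_sum_right intro!: sum.cong)
    show "linear_map_on (span S) (\<lambda>v. v)"
      by (simp add: linear_map_on_def)
    show "(\<Sum>s\<in>S. \<gamma> s b *\<^sub>R s) = b" if b: "b \<in> S" for b
    proof -
      have "(\<Sum>s\<in>S. \<gamma> s b *\<^sub>R s) = (\<Sum>s\<in>{b}. \<gamma> s b *\<^sub>R s)"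
        using b S(1) \<gamma>(3) by (intro sum.mono_neutral_right) auto
      then show ?thesis using \<gamma>(2) b by simp
    qed
    show "v \<in> span S" by (rule that)
  qed
  have "continuous_map ?K L (\<lambda>v. \<Sum>s\<in>S. \<gamma> s v *\<^sub>R s)"
    using \<gamma>(1) SL span_base
    by (intro lcs_continuous_map_sum lcs_continuous_map_scaleR L S(1)
        continuous_map_from_subtopology continuous_map_weak_topology_functional)
      (auto simp: subset_iff)
  then have "continuous_map ?K L (\<lambda>v. v)"
    by (rule continuous_map_eq) (use S(3) expand in auto)
  moreover have "compactin ?K K"
    using K(2) by (simp add: compactin_subtopology)
  ultimately show ?thesis
    using image_compactin[of ?K K L "\<lambda>v. v"] by simp
qed

theorem theorem1p6:
  fixes X :: "'x topology" and L :: "'l::real_vector topology" and i :: "'x \<Rightarrow> 'l"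
  assumes "Tychonoff_space X" and "free_locally_convex_space X L i"
  shows "Dunford_Pettis_property TYPE('f::real_vector) L"
  unfolding Dunford_Pettis_property_def
proof (intro allI impI, elim conjE)
  fix F :: "'f topology" and T K
  assume F: "locally_convex_space F" and T: "continuous_linear_operator L F T"
    and K: "absolutely_convex K" "compactin (weak_topology L) K"
  have "compactin L K"
    using weakly_compact_convex_imp_compact[OF assms] K unfolding absolutely_convex_def by blast
  then have TK: "compactin F (T ` K)"
    using T image_compactin unfolding continuous_linear_operator_def by blast
  then have "closedin F (T ` K)"
    using compactin_imp_closedin lcsD(4)[OF F] by blast
  then show "relatively_compactin F (T ` K)"
    using TK unfolding relatively_compactin_def
    by (simp add: closure_of_closedin closedin_subset)
qed

end
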